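(* Let $\mathfrak{L}$ be a non-zero finite-dimensional nilpotent left Leibniz algebra over a field $\mathbb{F}$. Then $\mathrm{HL}^n(\mathfrak{L},\mathbb{F})\neq 0$ for every non-negative integer $n$.
   Context: A left Leibniz algebra over a field $\mathbb{F}$ is an $\mathbb{F}$-vector space $\mathfrak{L}$ with a bilinear multiplication satisfying $x(yz)=(xy)z+y(xz)$ for all $x,y,z\in\mathfrak{L}$. It is nilpotent if there is a positive integer $n$ such that any product of $n$ elements of $\mathfrak{L}$, no matter how associated, is zero. Here $\mathbb{F}$ is the one-dimensional trivial $\mathfrak{L}$-bimodule (both the left and the right action are zero). Leibniz cohomology: for an $\mathfrak{L}$-bimodule $M$ (with left and right actions written $x\cdot m$, $m\cdot x$) and $n\ge 0$ let $\mathrm{CL}^n(\mathfrak{L},M):=\mathrm{Hom}_{\mathbb{F}}(\mathfrak{L}^{\otimes n},M)$ and $\mathrm{d}^n:\mathrm{CL}^n(\mathfrak{L},M)\to\mathrm{CL}^{n+1}(\mathfrak{L},M)$, $$(\mathrm{d}^nf)(x_1\otimes\dots\otimes x_{n+1})=\sum_{j=1}^n(-1)^{j+1}x_j\cdot f(x_1\otimes\dots\otimes\hat{x}_j\otimes\dots\otimes x_{n+1})+(-1)^{n+1}f(x_1\otimes\dots\otimes x_n)\cdot x_{n+1}+\sum_{1\le i<j\le n+1}(-1)^if(x_1\otimes\dots\otimes\hat{x}_i\otimes\dots\otimes x_{j-1}\otimes x_ix_j\otimes x_{j+1}\otimes\dots\otimes x_{n+1}).$$ This is a cochain complex, and $\mathrm{HL}^n(\mathfrak{L},M):=\operatorname{Ker}(\mathrm{d}^n)/\operatorname{Im}(\mathrm{d}^{n-1})$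 with $\mathrm{d}^{-1}:=0$. *)

theory Defs
  imports Complex_Main
begin

locale leibniz_algebra = vector_space scale
  for scale :: "'k::field \<Rightarrow> 'l::ab_group_add \<Rightarrow> 'l" +
  fixes mul :: "'l \<Rightarrow> 'l \<Rightarrow> 'l"
  assumes linear_mul_right: "Vector_Spaces.linear scale scale (\<lambda>y. mul x y)"
    and linear_mul_left: "Vector_Spaces.linear scale scale (\<lambda>x. mul x y)"
    and left_leibniz: "mul x (mul y z) = mul (mul x y) z + mul y (mul x z)"

(* is_product mul n x: x is a product of n elements, associated in some way. *)
inductive is_product :: "('l \<Rightarrow> 'l \<Rightarrow> 'l) \<Rightarrow> nat \<Rightarrow> 'l \<Rightarrow> bool"
  for mul :: "'l \<Rightarrow> 'l \<Rightarrow> 'l" where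
  single: "is_product mul 1 x"
| mult: "is_product mul m x \<Longrightarrow> is_product mul n y \<Longrightarrow> is_product mul (m + n) (mul x y)"

definition nilpotent_algebra :: "('l::zero \<Rightarrow> 'l \<Rightarrow> 'l) \<Rightarrow> bool" where
  "nilpotent_algebra mul \<longleftrightarrow> (\<exists>n>0. \<forall>x. is_product mul n x \<longrightarrow> x = 0)"

locale leibniz_bimodule = leibniz_algebra scale mul + M: vector_space scaleM
  for scale :: "'k::field \<Rightarrow> 'l::ab_group_add \<Rightarrow> 'l"
    and mul :: "'l \<Rightarrow> 'l \<Rightarrow> 'l"
    and scaleM :: "'k \<Rightarrow> 'm::ab_group_add \<Rightarrow> 'm" +
  fixes lact :: "'l \<Rightarrow> 'm \<Rightarrow> 'm"
    and ract :: "'m \<Rightarrow> 'l \<Rightarrow> 'm"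
  assumes linear_lact: "Vector_Spaces.linear scaleM scaleM (\<lambda>m. lact x m)"
    and linear_lact_alg: "Vector_Spaces.linear scale scaleM (\<lambda>x. lact x m)"
    and linear_ract: "Vector_Spaces.linear scaleM scaleM (\<lambda>m. ract m x)"
    and linear_ract_alg: "Vector_Spaces.linear scale scaleM (\<lambda>x. ract m x)"
    and LLM: "lact (mul x y) m = lact x (lact y m) - lact y (lact x m)"
    and LML: "ract (lact x m) y = lact x (ract m y) - ract m (mul x y)"
    and MLL: "ract (ract m x) y = ract m (mul x y) - lact x (ract m y)"

lemma leibniz_bimodule_trivial:
  fixes scale :: "'k::field \<Rightarrow> 'l::ab_group_add \<Rightarrow> 'l"
  assumes "leibniz_algebra scale mul"
  shows "leibniz_bimodule scale mul ((*) :: 'k \<Rightarrow> 'k \<Rightarrow> 'k) (\<lambda>_ _. 0) (\<lambda>_ _. 0)"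
proof -
  interpret L: leibniz_algebra scale mul by fact
  interpret F: vector_space "(*) :: 'k \<Rightarrow> 'k \<Rightarrow> 'k"
    by unfold_locales (simp_all add: algebra_simps)
  show ?thesis
    by unfold_locales simp_all
qed

(* Linear maps from the n-th tensor power of L to M, given by their values
   f [x_1, ..., x_n] on elementary tensors, i.e. as n-fold multilinear maps.
   The value 0 on lists of any other length makes this representation unique. *)
definition CL :: "('k::field \<Rightarrow> 'l::ab_group_add \<Rightarrow> 'l) \<Rightarrow> ('k \<Rightarrow> 'm::ab_group_add \<Rightarrow> 'm)
    \<Rightarrow> nat \<Rightarrow> ('l list \<Rightarrow> 'm) set" where
  "CL scale scaleM n = {f.
     (\<forall>xs. length xs = n \<longrightarrow>
        (\<forall>i<n. Vector_Spaces.linear scale scaleM (\<lambda>x. f (xs[i := x])))) \<and>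
     (\<forall>xs. length xs \<noteq> n \<longrightarrow> f xs = 0)}"

definition omit :: "nat \<Rightarrow> 'l list \<Rightarrow> 'l list" where
  "omit i xs = take i xs @ drop (Suc i) xs"

(* List positions start at 0: the indices i, j below are one less than in the usual
   formula for the Leibniz coboundary of x_1, ..., x_{n+1}, so that the signs
   (-1)^(j+1) of the first sum and (-1)^i of the last become (-1)^j and (-1)^(i+1). *)
definition leibniz_d :: "('l \<Rightarrow> 'l \<Rightarrow> 'l) \<Rightarrow> ('k::field \<Rightarrow> 'm::ab_group_add \<Rightarrow> 'm)
    \<Rightarrow> ('l \<Rightarrow> 'm \<Rightarrow> 'm) \<Rightarrow> ('m \<Rightarrow> 'l \<Rightarrow> 'm)
    \<Rightarrow> nat \<Rightarrow> ('l list \<Rightarrow> 'm) \<Rightarrow> 'l list \<Rightarrow> 'm" where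
  "leibniz_d mul scaleM lact ract n f xs =
    (if length xs = Suc n then
       (\<Sum>j<n. scaleM ((-1) ^ j) (lact (xs ! j) (f (omit j xs))))
       + scaleM ((-1) ^ Suc n) (ract (f (take n xs)) (xs ! n))
       + (\<Sum>j\<le>n. \<Sum>i<j. scaleM ((-1) ^ Suc i)
            (f (omit i (xs[j := mul (xs ! i) (xs ! j)]))))
     else 0)"

definition leibniz_cocycles :: "('k::field \<Rightarrow> 'l::ab_group_add \<Rightarrow> 'l) \<Rightarrow> ('l \<Rightarrow> 'l \<Rightarrow> 'l)
    \<Rightarrow> ('k \<Rightarrow> 'm::ab_group_add \<Rightarrow> 'm) \<Rightarrow> ('l \<Rightarrow> 'm \<Rightarrow> 'm) \<Rightarrow> ('m \<Rightarrow> 'l \<Rightarrow> 'm)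
    \<Rightarrow> nat \<Rightarrow> ('l list \<Rightarrow> 'm) set" where
  "leibniz_cocycles scale mul scaleM lact ract n =
     {f \<in> CL scale scaleM n. leibniz_d mul scaleM lact ract n f = (\<lambda>_. 0)}"

definition leibniz_coboundaries :: "('k::field \<Rightarrow> 'l::ab_group_add \<Rightarrow> 'l) \<Rightarrow> ('l \<Rightarrow> 'l \<Rightarrow> 'l)
    \<Rightarrow> ('k \<Rightarrow> 'm::ab_group_add \<Rightarrow> 'm) \<Rightarrow> ('l \<Rightarrow> 'm \<Rightarrow> 'm) \<Rightarrow> ('m \<Rightarrow> 'l \<Rightarrow> 'm)
    \<Rightarrow> nat \<Rightarrow> ('l list \<Rightarrow> 'm) set" where
  "leibniz_coboundaries scale mul scaleM lact ract n =
     (case n of 0 \<Rightarrow> {\<lambda>_. 0}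
      | Suc m \<Rightarrow> leibniz_d mul scaleM lact ract m ` CL scale scaleM m)"

definition leibniz_class :: "('k::field \<Rightarrow> 'l::ab_group_add \<Rightarrow> 'l) \<Rightarrow> ('l \<Rightarrow> 'l \<Rightarrow> 'l)
    \<Rightarrow> ('k \<Rightarrow> 'm::ab_group_add \<Rightarrow> 'm) \<Rightarrow> ('l \<Rightarrow> 'm \<Rightarrow> 'm) \<Rightarrow> ('m \<Rightarrow> 'l \<Rightarrow> 'm)
    \<Rightarrow> nat \<Rightarrow> ('l list \<Rightarrow> 'm) \<Rightarrow> ('l list \<Rightarrow> 'm) set" where
  "leibniz_class scale mul scaleM lact ract n f =
     {(\<lambda>xs. f xs + g xs) | g. g \<in> leibniz_coboundaries scale mul scaleM lact ract n}"

(* The underlying set of the quotient space; its zero is the class of the zero cochain. *)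
definition HL :: "('k::field \<Rightarrow> 'l::ab_group_add \<Rightarrow> 'l) \<Rightarrow> ('l \<Rightarrow> 'l \<Rightarrow> 'l)
    \<Rightarrow> ('k \<Rightarrow> 'm::ab_group_add \<Rightarrow> 'm) \<Rightarrow> ('l \<Rightarrow> 'm \<Rightarrow> 'm) \<Rightarrow> ('m \<Rightarrow> 'l \<Rightarrow> 'm)
    \<Rightarrow> nat \<Rightarrow> ('l list \<Rightarrow> 'm) set set" where
  "HL scale mul scaleM lact ract n =
     leibniz_class scale mul scaleM lact ract n
       ` leibniz_cocycles scale mul scaleM lact ract n"

lemma (in leibniz_bimodule) zero_class_in_HL:
  "leibniz_class scale mul scaleM lact ract n (\<lambda>_. 0) \<in> HL scale mul scaleM lact ract n"
proof -
  have [simp]: "lact x 0 = 0" "ract 0 x = 0" for x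
    using module_hom.zero[OF linear_lact[unfolded linear_iff_module_hom]]
      module_hom.zero[OF linear_ract[unfolded linear_iff_module_hom]] by simp_all
  have "Vector_Spaces.linear scale scaleM (\<lambda>_. 0)"
    by unfold_locales simp_all
  then have "(\<lambda>_. 0) \<in> leibniz_cocycles scale mul scaleM lact ract n"
    by (auto simp: leibniz_cocycles_def CL_def leibniz_d_def fun_eq_iff)
  then show ?thesis
    by (auto simp: HL_def)
qed

end

theory Submission
  imports Defs
begin

text \<open>
  Let \<open>z \<noteq> 0\<close> satisfy \<open>L z = 0\<close> and suppose that every cocycle of degree \<open>n + 1\<close> is a coboundary.
  Filtering \<open>L\<close> by left ideals \<open>V\<close> with \<open>L V\<^sub>i\<^sub>+\<^sub>1 \<subseteq> V\<^sub>i\<close> shows that a cocycle of degree \<open>n + 2\<close>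
  that vanishes when its last argument lies in \<open>V\<close> is the coboundary of a cochain with the same
  property.  Given a cocycle \<open>f\<close> of degree \<open>n\<close> and a functional \<open>\<mu>\<close> with \<open>\<mu> z = 1\<close>, the coboundary of
  \<open>f \<otimes> \<mu>\<close> vanishes when the last argument is \<open>z\<close>, hence \<open>d (f \<otimes> \<mu>) = d g\<close> with \<open>g\<close> vanishing there, and
  \<open>f \<otimes> \<mu> - g = d h\<close>.  Inserting \<open>z\<close> as last argument gives \<open>f = d (h (\<dots>, z))\<close>.  So the vanishing of
  cohomology descends from degree \<open>n + 1\<close> to degree \<open>n\<close> and finally to degree \<open>0\<close>, where it fails.
\<close>

section \<open>Linear functionals and bilinearity of the product\<close>

lemma (in leibniz_algebra) linear_to_field_iff:
  "Vector_Spaces.linear scale ((*) :: 'k \<Rightarrow> 'k \<Rightarrow> 'k) g \<longleftrightarrow>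
     (\<forall>x y. g (x + y) = g x + g y) \<and> (\<forall>c x. g (scale c x) = c * g x)"
proof -
  interpret F: vector_space "(*) :: 'k \<Rightarrow> 'k \<Rightarrow> 'k"
    by unfold_locales (simp_all add: algebra_simps)
  show ?thesis
    unfolding Vector_Spaces.linear_iff using vector_space_axioms F.vector_space_axioms by blast
qed

lemma (in leibniz_algebra) mul_add_right: "mul x (y + y') = mul x y + mul x y'"
  and mul_scale_right: "mul x (scale c y) = scale c (mul x y)"
  and mul_add_left: "mul (x + x') y = mul x y + mul x' y"
  and mul_scale_left: "mul (scale c x) y = scale c (mul x y)"
proof -
  show "mul x (y + y') = mul x y + mul x y'" "mul x (scale c y) = scale c (mul x y)"
    using linear_mul_right[of x] unfolding Vector_Spaces.linear_iff by auto
  show "mul (x + x') y = mul x y + mul x' y" "mul (scale c x) y = scale c (mul x y)"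
    using linear_mul_left[of y] unfolding Vector_Spaces.linear_iff by auto
qed

section \<open>Lie derivatives and the coboundary as recursions on argument lists\<close>

fun lie :: "('l \<Rightarrow> 'l \<Rightarrow> 'l) \<Rightarrow> 'l \<Rightarrow> ('l list \<Rightarrow> 'm::ab_group_add) \<Rightarrow> 'l list \<Rightarrow> 'm" where
  "lie mul x f [] = 0"
| "lie mul x f (y # ys) = f (mul x y # ys) + lie mul x (\<lambda>zs. f (y # zs)) ys"

text \<open>The coboundary for trivial coefficients, defined by Cartan's formula
  \<open>\<iota>\<^sub>x d + d \<iota>\<^sub>x = - \<theta>\<^sub>x\<close>, where \<open>\<iota>\<^sub>x\<close> inserts \<open>x\<close> as first argument and \<open>\<theta>\<^sub>x\<close> is \<^term>\<open>lie mul x\<close>.\<close>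

fun cartan_d :: "('l \<Rightarrow> 'l \<Rightarrow> 'l) \<Rightarrow> ('l list \<Rightarrow> 'm::ab_group_add) \<Rightarrow> 'l list \<Rightarrow> 'm" where
  "cartan_d mul f [] = 0"
| "cartan_d mul f (x # ys) = - lie mul x f ys - cartan_d mul (\<lambda>zs. f (x # zs)) ys"

lemma lie_0 [simp]: "lie mul x (\<lambda>_. 0) xs = 0"
  by (induction xs) auto

lemma lie_add: "lie mul x (\<lambda>zs. f zs + g zs) xs = lie mul x f xs + lie mul x g xs"
  by (induction xs arbitrary: f g) auto

lemma lie_diff: "lie mul x (\<lambda>zs. f zs - g zs) xs = lie mul x f xs - lie mul x g xs"
  by (induction xs arbitrary: f g) auto

lemma lie_uminus: "lie mul x (\<lambda>zs. - f zs) xs = - lie mul x f xs"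
  using lie_diff[of mul x "\<lambda>_. 0" f xs] by simp

lemma lie_mult_left:
  fixes c :: "'k::comm_ring"
  shows "lie mul x (\<lambda>zs. c * f zs) xs = c * lie mul x f xs"
  by (induction xs arbitrary: f) (auto simp: algebra_simps)

lemma cartan_d_0 [simp]: "cartan_d mul (\<lambda>_. 0) xs = 0"
  by (induction xs) auto

lemma cartan_d_add: "cartan_d mul (\<lambda>zs. f zs + g zs) xs = cartan_d mul f xs + cartan_d mul g xs"
  by (induction xs arbitrary: f g) (auto simp: lie_add)

lemma cartan_d_diff: "cartan_d mul (\<lambda>zs. f zs - g zs) xs = cartan_d mul f xs - cartan_d mul g xs"
  by (induction xs arbitrary: f g) (auto simp: lie_diff)

lemma cartan_d_uminus: "cartan_d mul (\<lambda>zs. - f zs) xs = - cartan_d mul f xs"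
  using cartan_d_diff[of mul "\<lambda>_. 0" f xs] by simp

lemma cartan_d_mult_left:
  fixes c :: "'k::comm_ring"
  shows "cartan_d mul (\<lambda>zs. c * f zs) xs = c * cartan_d mul f xs"
  by (induction xs arbitrary: f) (auto simp: lie_mult_left algebra_simps)

lemma lie_snoc: "lie mul x f (xs @ [y]) = lie mul x (\<lambda>zs. f (zs @ [y])) xs + f (xs @ [mul x y])"
  by (induction xs arbitrary: f) (auto simp: algebra_simps)

text \<open>The coboundary never omits the last argument; it only replaces \<open>y\<close> by
  products \<open>mul x y\<close>. Once \<open>f\<close> kills those replacements, the last slot is
  a mere parameter.\<close>

lemma cartan_d_snoc:
  assumes "\<And>zs x. f (zs @ [mul x y]) = 0"
  shows "cartan_d mul f (xs @ [y]) = cartan_d mul (\<lambda>zs. f (zs @ [y])) xs"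
  using assms
proof (induction xs arbitrary: f)
  case (Cons x xs)
  have "cartan_d mul (\<lambda>zs. f (x # zs)) (xs @ [y]) = cartan_d mul (\<lambda>zs. f (x # zs @ [y])) xs"
    using Cons.prems[of "x # zs" for zs] by (intro Cons.IH) simp
  then show ?case by (simp add: lie_snoc Cons.prems)
qed simp

lemma lie_eq_sum: "lie mul x f ys = (\<Sum>j<length ys. f (ys[j := mul x (ys ! j)]))"
  by (induction ys arbitrary: f) (auto simp: sum.lessThan_Suc_shift simp del: sum.lessThan_Suc)

text \<open>Splitting the double sum at \<open>i = 0\<close> reproduces the recursion: these terms
  give \<open>- lie mul x f ys\<close>, and in the others \<open>x\<close> stays in front while the
  index shift flips the sign.\<close>

lemma cartan_d_eq_sum:
  fixes f :: "'l list \<Rightarrow> 'k::comm_ring_1"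
  shows "cartan_d mul f xs = (\<Sum>j<length xs. \<Sum>i<j.
    (-1) ^ Suc i * f (omit i (xs[j := mul (xs ! i) (xs ! j)])))"
proof (induction xs arbitrary: f)
  case (Cons x xs)
  show ?case
    by (simp add: Cons.IH lie_eq_sum sum.lessThan_Suc_shift omit_def sum.distrib sum_negf
        sum_subtractf del: sum.lessThan_Suc)
qed simp

lemma leibniz_d_eq_cartan_d:
  fixes f :: "'l list \<Rightarrow> 'k::field"
  shows "leibniz_d mul (*) (\<lambda>_ _. 0) (\<lambda>_ _. 0) n f xs =
    (if length xs = Suc n then cartan_d mul f xs else 0)"
  by (simp add: leibniz_d_def cartan_d_eq_sum lessThan_Suc_atMost del: sum.lessThan_Suc)

section \<open>Multilinear cochains and operations on their first and last slots\<close>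

context leibniz_algebra
begin

abbreviation cochains :: "nat \<Rightarrow> ('l list \<Rightarrow> 'k) set" where
  "cochains \<equiv> CL scale (*)"

abbreviation is_linear :: "('l \<Rightarrow> 'k) \<Rightarrow> bool" where
  "is_linear \<equiv> Vector_Spaces.linear scale (*)"

lemma cochains_length: "f \<in> cochains n \<Longrightarrow> length xs \<noteq> n \<Longrightarrow> f xs = 0"
  by (auto simp: CL_def)

lemma cochains_linear:
  "f \<in> cochains n \<Longrightarrow> length xs = n \<Longrightarrow> i < n \<Longrightarrow> is_linear (\<lambda>x. f (xs[i := x]))"
  by (auto simp: CL_def)

text \<open>Currying the first argument lets inductions on the degree follow the recursions of
  \<open>lie\<close> and \<open>cartan_d\<close>. Linearity can be asked for tails \<open>zs\<close>
  of any length because cochains are 0 on lists of the wrong length.\<close>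

lemma cochains_Suc_iff:
  "f \<in> cochains (Suc n) \<longleftrightarrow>
     f [] = 0 \<and> (\<forall>x. (\<lambda>zs. f (x # zs)) \<in> cochains n) \<and> (\<forall>zs. is_linear (\<lambda>x. f (x # zs)))"
  (is "?L \<longleftrightarrow> ?R")
proof
  assume L: ?L
  have "is_linear (\<lambda>x. f (x # zs))" for zs
  proof (cases "length zs = n")
    case True
    \<comment> \<open>The entry \<open>undefined\<close> is a placeholder that the update
      overwrites.\<close>
    have "is_linear (\<lambda>x. f ((undefined # zs)[0 := x]))"
      using L True by (intro cochains_linear) auto
    then show ?thesis by simp
  next
    case False
    then show ?thesis using cochains_length[OF L] by (simp add: linear_to_field_iff)
  qed
  moreover have "(\<lambda>zs. f (x # zs)) \<in> cochains n" for x
  proof -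
    have "is_linear (\<lambda>y. f (x # zs[i := y]))" if "length zs = n" "i < n" for zs i
    proof -
      have "is_linear (\<lambda>y. f ((x # zs)[Suc i := y]))"
        using L that by (intro cochains_linear) auto
      then show ?thesis by simp
    qed
    then show ?thesis using cochains_length[OF L] by (auto simp: CL_def)
  qed
  ultimately show ?R using cochains_length[OF L] by simp
next
  assume R: ?R
  have "is_linear (\<lambda>x. f (xs[i := x]))" if len: "length xs = Suc n" and i: "i < Suc n" for xs i
  proof -
    obtain y ys where xs: "xs = y # ys" "length ys = n" using len by (auto simp: length_Suc_conv)
    show ?thesis
    proof (cases i)
      case 0
      then show ?thesis using R xs by simp
    next
      case (Suc k)
      moreover have "is_linear (\<lambda>x. f (y # ys[k := x]))"
        using R xs(2) i Suc by (intro cochains_linear) auto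
      ultimately show ?thesis using xs by simp
    qed
  qed
  moreover have "f xs = 0" if "length xs \<noteq> Suc n" for xs
  proof (cases xs)
    case (Cons y ys)
    have "(\<lambda>zs. f (y # zs)) \<in> cochains n" using R by blast
    then show ?thesis using cochains_length[of "\<lambda>zs. f (y # zs)" n ys] Cons that by simp
  qed (use R in simp)
  ultimately show ?L by (simp add: CL_def)
qed

lemma cochains_0_iff: "f \<in> cochains 0 \<longleftrightarrow> (\<forall>x xs. f (x # xs) = 0)"
  by (auto simp: CL_def neq_Nil_conv)

lemma lie_cochains_0: "f \<in> cochains 0 \<Longrightarrow> lie mul x f = (\<lambda>_. 0)"
proof
  fix xs assume "f \<in> cochains 0"
  then show "lie mul x f xs = 0" by (cases xs) (simp_all add: cochains_0_iff)
qed

lemma cartan_d_cochains_0: "f \<in> cochains 0 \<Longrightarrow> cartan_d mul f = (\<lambda>_. 0)"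
proof
  fix xs assume "f \<in> cochains 0"
  then show "cartan_d mul f xs = 0"
    using lie_cochains_0[of f] by (cases xs) (simp_all add: cochains_0_iff)
qed

lemma cochains_zero: "(\<lambda>_. 0) \<in> cochains n"
  by (auto simp: CL_def linear_to_field_iff)

lemma cochains_add: "f \<in> cochains n \<Longrightarrow> g \<in> cochains n \<Longrightarrow> (\<lambda>xs. f xs + g xs) \<in> cochains n"
  by (auto simp: CL_def linear_to_field_iff algebra_simps)

lemma cochains_diff: "f \<in> cochains n \<Longrightarrow> g \<in> cochains n \<Longrightarrow> (\<lambda>xs. f xs - g xs) \<in> cochains n"
  by (auto simp: CL_def linear_to_field_iff algebra_simps)

lemma cochains_uminus: "f \<in> cochains n \<Longrightarrow> (\<lambda>xs. - f xs) \<in> cochains n"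
  using cochains_diff[OF cochains_zero, of f n] by simp

lemma is_linear_last:
  assumes "f \<in> cochains (Suc n)"
  shows "is_linear (\<lambda>y. f (xs @ [y]))"
proof (cases "length xs = n")
  case True
  have "is_linear (\<lambda>y. f ((xs @ [undefined])[n := y]))"
    using assms True by (intro cochains_linear) auto
  then show ?thesis using True by auto
next
  case False
  then show ?thesis using cochains_length[OF assms] by (simp add: linear_to_field_iff)
qed

lemma cochains_fix_last:
  assumes "f \<in> cochains (Suc n)"
  shows "(\<lambda>xs. f (xs @ [y])) \<in> cochains n"
proof -
  have "is_linear (\<lambda>x. f (xs[i := x] @ [y]))" if "length xs = n" "i < n" for xs i
  proof -
    have "is_linear (\<lambda>x. f ((xs @ [y])[i := x]))"
      using that by (intro cochains_linear[OF assms]) auto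
    then show ?thesis using that by (simp add: list_update_append)
  qed
  then show ?thesis using cochains_length[OF assms] by (auto simp: CL_def)
qed

text \<open>The cochain f \<otimes> \<mu> of the outline. The default 0 at the empty list keeps it a
  cochain of positive degree.\<close>

definition tensor_last :: "('l list \<Rightarrow> 'k) \<Rightarrow> ('l \<Rightarrow> 'k) \<Rightarrow> 'l list \<Rightarrow> 'k" where
  "tensor_last f \<mu> xs = (if xs = [] then 0 else f (butlast xs) * \<mu> (last xs))"

lemma tensor_last_snoc [simp]: "tensor_last f \<mu> (xs @ [y]) = f xs * \<mu> y"
  by (simp add: tensor_last_def)

lemma tensor_last_cochains:
  assumes "f \<in> cochains n" "is_linear \<mu>"
  shows "tensor_last f \<mu> \<in> cochains (Suc n)"
proof -
  have "is_linear (\<lambda>x. tensor_last f \<mu> (xs[i := x]))" if len: "length xs = Suc n" and i: "i < Suc n" for xs i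
  proof -
    obtain ys y where xs: "xs = ys @ [y]" "length ys = n"
      using len by (auto simp: length_Suc_conv_rev)
    show ?thesis
    proof (cases "i < n")
      case True
      then show ?thesis
        using cochains_linear[OF assms(1) xs(2) True] xs
        by (simp add: list_update_append linear_to_field_iff algebra_simps)
    next
      case False
      then have "xs[i := x] = ys @ [x]" for x using xs i by (auto simp: less_Suc_eq)
      then show ?thesis using assms(2) by (simp add: linear_to_field_iff algebra_simps)
    qed
  qed
  moreover have "tensor_last f \<mu> xs = 0" if "length xs \<noteq> Suc n" for xs
    using that cochains_length[OF assms(1)] by (cases xs rule: rev_cases) (auto simp: tensor_last_def)
  ultimately show ?thesis by (auto simp: CL_def)
qed

text \<open>Since \<mu> kills every \<open>mul x y\<close>, the last slot is a parameter and
  contributes only the constant factor \<open>\<mu> y\<close>.\<close>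

lemma cartan_d_tensor_last:
  assumes "\<And>x. \<mu> (mul x y) = 0"
  shows "cartan_d mul (tensor_last f \<mu>) (xs @ [y]) = \<mu> y * cartan_d mul f xs"
  using assms by (simp add: cartan_d_snoc cartan_d_mult_left mult.commute[of _ "\<mu> y"])

section \<open>Cartan calculus and the identity d d = 0\<close>

lemma lie_add_left: "f \<in> cochains n \<Longrightarrow> lie mul (x + y) f xs = lie mul x f xs + lie mul y f xs"
proof (induction xs arbitrary: f n)
  case (Cons z xs)
  show ?case
  proof (cases n)
    case 0
    then show ?thesis using Cons.prems by (simp add: lie_cochains_0)
  next
    case (Suc m)
    then have f: "(\<lambda>zs. f (z # zs)) \<in> cochains m" "is_linear (\<lambda>x. f (x # xs))"
      using Cons.prems by (simp_all add: cochains_Suc_iff)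
    show ?thesis
      using Cons.IH[OF f(1)] f(2) by (simp add: linear_to_field_iff mul_add_left algebra_simps)
  qed
qed simp

lemma lie_scale_left: "f \<in> cochains n \<Longrightarrow> lie mul (scale c x) f xs = c * lie mul x f xs"
proof (induction xs arbitrary: f n)
  case (Cons z xs)
  show ?case
  proof (cases n)
    case 0
    then show ?thesis using Cons.prems by (simp add: lie_cochains_0)
  next
    case (Suc m)
    then have f: "(\<lambda>zs. f (z # zs)) \<in> cochains m" "is_linear (\<lambda>x. f (x # xs))"
      using Cons.prems by (simp_all add: cochains_Suc_iff)
    show ?thesis
      using Cons.IH[OF f(1)] f(2) by (simp add: linear_to_field_iff mul_scale_left algebra_simps)
  qed
qed simp

lemma lie_cochains: "f \<in> cochains n \<Longrightarrow> lie mul x f \<in> cochains n"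
proof (induction n arbitrary: f)
  case 0
  then show ?case by (simp add: cochains_0_iff)
next
  case (Suc n)
  then have f: "\<And>x. (\<lambda>zs. f (x # zs)) \<in> cochains n" "\<And>zs. is_linear (\<lambda>x. f (x # zs))"
    by (simp_all add: cochains_Suc_iff)
  have "is_linear (\<lambda>y. lie mul x f (y # zs))" for zs
    using f(2) by (simp add: linear_to_field_iff mul_add_right mul_scale_right lie_add lie_mult_left
        algebra_simps)
  then show ?case
    using f Suc.IH by (simp add: cochains_Suc_iff cochains_add)
qed

lemma cartan_d_cochains: "f \<in> cochains n \<Longrightarrow> cartan_d mul f \<in> cochains (Suc n)"
proof (induction n arbitrary: f)
  case 0
  then show ?case using cochains_zero by (simp add: cartan_d_cochains_0)
next
  case (Suc n)
  then have f: "\<And>x. (\<lambda>zs. f (x # zs)) \<in> cochains n" "\<And>zs. is_linear (\<lambda>x. f (x # zs))"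
    by (simp_all add: cochains_Suc_iff)
  \<comment> \<open>The head \<open>x\<close> enters both as the index of \<open>lie\<close> and as
    the first argument of \<open>f\<close>, so linearity is needed in both places.\<close>
  have "is_linear (\<lambda>x. cartan_d mul f (x # zs))" for zs
    using f(2) by (simp add: linear_to_field_iff lie_add_left[OF Suc.prems]
        lie_scale_left[OF Suc.prems] cartan_d_add cartan_d_mult_left algebra_simps)
  then show ?case
    using Suc.IH[OF f(1)] lie_cochains[OF Suc.prems]
    by (subst cochains_Suc_iff) (simp add: cochains_diff cochains_uminus)
qed

text \<open>Replacements in two different slots commute; in a single slot the left Leibniz identity
  supplies the correction. The order of \<open>x\<close> and \<open>y\<close> is reversed because
  cochains are contravariant.\<close>

lemma lie_lie:
  "f \<in> cochains n \<Longrightarrow>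
    lie mul x (lie mul y f) xs = lie mul y (lie mul x f) xs - lie mul (mul x y) f xs"
proof (induction xs arbitrary: f n)
  case (Cons z xs)
  show ?case
  proof (cases n)
    case 0
    then show ?thesis using Cons.prems by (simp add: lie_cochains_0)
  next
    case (Suc m)
    then have f: "\<And>x. (\<lambda>zs. f (x # zs)) \<in> cochains m" "\<And>zs. is_linear (\<lambda>x. f (x # zs))"
      using Cons.prems by (simp_all add: cochains_Suc_iff)
    have "f (mul x (mul y z) # xs) = f (mul (mul x y) z # xs) + f (mul y (mul x z) # xs)"
      using f(2) left_leibniz[of x y z] by (simp add: linear_to_field_iff)
    then show ?thesis
      using Cons.IH[OF f(1), of z] by (simp add: lie_add algebra_simps)
  qed
qed simp

text \<open>After expanding both sides at the first argument \<open>y\<close>, the terms with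
  \<open>mul x y\<close> inserted in front agree, the tails agree by induction, and
  \<open>lie_lie\<close> matches the remaining Lie derivatives.\<close>

lemma cartan_d_lie:
  "f \<in> cochains n \<Longrightarrow> cartan_d mul (lie mul x f) xs = lie mul x (cartan_d mul f) xs"
proof (induction xs arbitrary: f n)
  case (Cons y xs)
  show ?case
  proof (cases n)
    case 0
    then show ?thesis using Cons.prems by (simp add: lie_cochains_0 cartan_d_cochains_0)
  next
    case (Suc m)
    then have f: "\<And>x. (\<lambda>zs. f (x # zs)) \<in> cochains m" "\<And>zs. is_linear (\<lambda>x. f (x # zs))"
      using Cons.prems by (simp_all add: cochains_Suc_iff)
    show ?thesis
      using Cons.IH[OF f(1), of y] lie_lie[OF Cons.prems, of x y xs]
      by (simp add: lie_add lie_diff lie_uminus cartan_d_add algebra_simps)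
  qed
qed simp

text \<open>Inserting \<open>x\<close> into d d f and applying Cartan's formula twice leaves the
  commutator of d with the Lie derivative, which is zero, and d d of a cochain of lower
  degree.\<close>

lemma cartan_d_cartan_d: "f \<in> cochains n \<Longrightarrow> cartan_d mul (cartan_d mul f) xs = 0"
proof (induction xs arbitrary: f n)
  case (Cons x xs)
  show ?case
  proof (cases n)
    case 0
    then show ?thesis using Cons.prems by (simp add: cartan_d_cochains_0)
  next
    case (Suc m)
    then have "(\<lambda>zs. f (x # zs)) \<in> cochains m"
      using Cons.prems by (simp_all add: cochains_Suc_iff)
    from Cons.IH[OF this] cartan_d_lie[OF Cons.prems, of x xs]
    show ?thesis by (simp add: cartan_d_diff cartan_d_uminus)
  qed
qed simp

section \<open>Separating functionals, nilpotency and the filtration by left ideals\<close>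

lemma ex_functional:
  assumes "subspace V" "v \<notin> V"
  obtains \<mu> where "is_linear \<mu>" "\<And>y. y \<in> V \<Longrightarrow> \<mu> y = 0" "\<mu> v = 1"
proof -
  interpret F: vector_space "(*) :: 'k \<Rightarrow> 'k \<Rightarrow> 'k"
    by unfold_locales (simp_all add: algebra_simps)
  interpret P: vector_space_pair scale "(*) :: 'k \<Rightarrow> 'k \<Rightarrow> 'k" ..
  obtain B where B: "B \<subseteq> V" "independent B" "V \<subseteq> span B"
    using maximal_independent_subset[of V] by blast
  have "span B = V" using B(1,3) assms(1) by (rule span_subspace)
  then have ind: "independent (insert v B)" using B(2) assms(2) by (intro independent_insertI) simp_all
  obtain g where g: "is_linear g" "\<forall>x\<in>insert v B. g x = (if x = v then 1 else 0)"
    using P.linear_independent_extend[OF ind, of "\<lambda>x. if x = v then 1 else 0"] by blast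
  have "g y = 0" if "y \<in> V" for y
  proof (rule P.linear_eq_0_on_span[OF g(1)])
    show "g b = 0" if "b \<in> B" for b using g(2) B(1) that assms(2) by auto
    show "y \<in> span B" using that B(3) by auto
  qed
  then show thesis using that g by auto
qed

text \<open>Otherwise every element outside \<open>V\<close> could be multiplied from the left to
  stay outside \<open>V\<close>. Iteration would give products of any number of factors outside
  \<open>V\<close>, hence nonzero.\<close>

lemma nilpotent_ex_mul_in_subspace:
  assumes "nilpotent_algebra mul" "subspace V" "V \<noteq> UNIV"
  shows "\<exists>v. v \<notin> V \<and> (\<forall>x. mul x v \<in> V)"
proof (rule ccontr)
  assume "\<nexists>v. v \<notin> V \<and> (\<forall>x. mul x v \<in> V)"
  then have step: "\<exists>x. mul x v \<notin> V" if "v \<notin> V" for v using that by blast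
  have "\<exists>v. is_product mul (Suc m) v \<and> v \<notin> V" for m
  proof (induction m)
    case 0
    then show ?case using assms(3) is_product.single[of mul] by auto
  next
    case (Suc m)
    then obtain v x where "is_product mul (Suc m) v" "mul x v \<notin> V" using step by blast
    then show ?case using is_product.mult[OF is_product.single] by fastforce
  qed
  moreover obtain n where "n > 0" "\<forall>x. is_product mul n x \<longrightarrow> x = 0"
    using assms(1) by (auto simp: nilpotent_algebra_def)
  ultimately show False using subspace_0[OF assms(2)] by (metis Suc_pred)
qed

text \<open>For a left ideal \<open>V\<close>, the cochains vanishing when the last argument lies in \<open>V\<close> are the
  cochains of one degree less with values in the nilpotent left module \<open>(L/V)\<^sup>*\<close>.\<close>

lemma cocycle_vanishing_on_last:
  assumes fin: "finite_dimensional_vector_space scale B" and nil: "nilpotent_algebra mul"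
    and exact: "\<And>f. f \<in> cochains (Suc n) \<Longrightarrow> cartan_d mul f = (\<lambda>_. 0) \<Longrightarrow>
      \<exists>k\<in>cochains n. f = cartan_d mul k"
    and V: "subspace V" "\<And>x y. y \<in> V \<Longrightarrow> mul x y \<in> V"
    and h: "h \<in> cochains (Suc (Suc n))" "cartan_d mul h = (\<lambda>_. 0)"
      "\<And>xs y. y \<in> V \<Longrightarrow> h (xs @ [y]) = 0"
  shows "\<exists>g\<in>cochains (Suc n). h = cartan_d mul g \<and> (\<forall>xs. \<forall>y\<in>V. g (xs @ [y]) = 0)"
proof -
  interpret fd: finite_dimensional_vector_space scale B by (rule fin)
  \<comment> \<open>Induction on the codimension of \<open>V\<close>. The cocycle \<open>h\<close>
    varies too, since it is corrected by a coboundary before \<open>V\<close> is enlarged by one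
    dimension.\<close>
  from V h show ?thesis
  proof (induction "dim UNIV - dim V" arbitrary: V h rule: less_induct)
    case less
    note sub = \<open>subspace V\<close> and van = less.prems(5)
    show ?case
    proof (cases "V = UNIV")
      case True
      have "h xs = 0" for xs
        using van cochains_length[OF less.prems(3)] True by (cases xs rule: rev_cases) auto
      then have "h = cartan_d mul (\<lambda>_. 0)" by auto
      then show ?thesis by (intro bexI[OF _ cochains_zero]) auto
    next
      case False
      obtain v where v: "v \<notin> V" "\<And>x. mul x v \<in> V"
        using nilpotent_ex_mul_in_subspace[OF nil sub False] by blast
      obtain \<mu> where \<mu>: "is_linear \<mu>" "\<And>y. y \<in> V \<Longrightarrow> \<mu> y = 0" "\<mu> v = 1"
        using ex_functional[OF sub v(1)] by blast
      \<comment> \<open>Fixing the last argument to \<open>v\<close> commutes with the coboundary,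
        because \<open>h\<close> vanishes on \<open>V\<close>, which contains all
        \<open>mul x v\<close>.\<close>
      have "cartan_d mul (\<lambda>xs. h (xs @ [v])) xs = 0" for xs
        using less.prems(4) van v(2) by (subst cartan_d_snoc[symmetric]) auto
      then obtain k where k: "k \<in> cochains n" "(\<lambda>xs. h (xs @ [v])) = cartan_d mul k"
        using exact[OF cochains_fix_last[OF less.prems(3)], of v] by blast
      \<comment> \<open>The coboundary of k \<otimes> \<mu> agrees with \<open>h\<close> when the
        last argument is \<open>v\<close>, as \<open>\<mu> v = 1\<close>, and vanishes when it lies
        in \<open>V\<close>. Subtracting it makes \<open>h\<close> vanish on the span of
        \<open>V\<close> and \<open>v\<close>.\<close>
      define g\<^sub>0 where "g\<^sub>0 = tensor_last k \<mu>"
      have g\<^sub>0: "g\<^sub>0 \<in> cochains (Suc n)"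
        unfolding g\<^sub>0_def using k \<mu> by (intro tensor_last_cochains)
      let ?h = "\<lambda>xs. h xs - cartan_d mul g\<^sub>0 xs" and ?V = "span (insert v V)"
      have hV: "?h \<in> cochains (Suc (Suc n))"
        using less.prems(3) cartan_d_cochains[OF g\<^sub>0] by (rule cochains_diff)
      have span_V: "span V = V" using sub by (simp add: span_eq_iff)
      have decomp: "\<exists>c. y - scale c v \<in> V" if "y \<in> ?V" for y
        using that unfolding span_breakdown_eq span_V .
      have "?h (xs @ [y]) = 0" if "y \<in> ?V" for xs y
      proof -
        obtain c w where y: "y = w + scale c v" "w \<in> V"
          using decomp[OF \<open>y \<in> ?V\<close>] by (metis diff_add_cancel)
        have "?h (xs @ [w]) = 0"
          using y(2) van \<mu> less.prems(2) by (simp add: g\<^sub>0_def cartan_d_tensor_last)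
        moreover have "?h (xs @ [v]) = 0"
          using \<mu> v(2) fun_cong[OF k(2), of xs] by (simp add: g\<^sub>0_def cartan_d_tensor_last)
        ultimately show ?thesis
          using is_linear_last[OF hV, of xs] unfolding y linear_to_field_iff by simp
      qed
      moreover have "mul x y \<in> ?V" if "y \<in> ?V" for x y
      proof -
        obtain c w where y: "y = w + scale c v" "w \<in> V"
          using decomp[OF \<open>y \<in> ?V\<close>] by (metis diff_add_cancel)
        have "mul x y \<in> V"
          using y v(2) less.prems(2) sub
          by (simp add: mul_add_right mul_scale_right subspace_add subspace_scale)
        then show ?thesis by (simp add: span_base)
      qed
      moreover have "cartan_d mul ?h = (\<lambda>_. 0)"
        using less.prems(4) cartan_d_cartan_d[OF g\<^sub>0] by (simp add: cartan_d_diff fun_eq_iff)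
      moreover have "dim UNIV - dim ?V < dim UNIV - dim V"
      proof -
        have "dim ?V = Suc (dim V)" using v(1) by (simp add: fd.dim_insert span_V)
        moreover have "dim ?V \<le> dim UNIV" by (intro fd.dim_subset) simp
        ultimately show ?thesis by linarith
      qed
      ultimately obtain g where g: "g \<in> cochains (Suc n)" "?h = cartan_d mul g"
          "\<forall>xs. \<forall>y\<in>?V. g (xs @ [y]) = 0"
        using less.hyps[of ?V ?h] hV subspace_span by blast
      have "h xs = cartan_d mul (\<lambda>zs. g\<^sub>0 zs + g zs) xs" for xs
        using fun_cong[OF g(2), of xs] by (simp add: cartan_d_add algebra_simps)
      moreover have "g\<^sub>0 (xs @ [y]) + g (xs @ [y]) = 0" if "y \<in> V" for xs y
        using that g(3) \<mu> by (simp add: g\<^sub>0_def span_base)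
      ultimately show ?thesis using cochains_add[OF g\<^sub>0 g(1)] by blast
    qed
  qed
qed

section \<open>Descent of exactness and its failure in every degree\<close>

abbreviation coboundaries :: "nat \<Rightarrow> ('l list \<Rightarrow> 'k) set" where
  "coboundaries \<equiv> leibniz_coboundaries scale mul (*) (\<lambda>_ _. 0) (\<lambda>_ _. 0)"

abbreviation cocycles :: "nat \<Rightarrow> ('l list \<Rightarrow> 'k) set" where
  "cocycles \<equiv> leibniz_cocycles scale mul (*) (\<lambda>_ _. 0) (\<lambda>_ _. 0)"

lemma leibniz_d_cochain:
  assumes "f \<in> cochains n"
  shows "leibniz_d mul (*) (\<lambda>_ _. 0) (\<lambda>_ _. 0) n f = cartan_d mul f"
  using cochains_length[OF cartan_d_cochains[OF assms]] by (auto simp: leibniz_d_eq_cartan_d fun_eq_iff)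

lemma cocycles_eq: "cocycles n = {f \<in> cochains n. cartan_d mul f = (\<lambda>_. 0)}"
  by (auto simp: leibniz_cocycles_def leibniz_d_cochain)

lemma coboundaries_0: "coboundaries 0 = {\<lambda>_. 0}"
  by (simp add: leibniz_coboundaries_def)

lemma coboundaries_Suc: "coboundaries (Suc n) = cartan_d mul ` cochains n"
  by (auto simp: leibniz_coboundaries_def leibniz_d_cochain)

lemma exact_descend:
  assumes fin: "finite_dimensional_vector_space scale B" and nil: "nilpotent_algebra mul"
    and nonzero: "\<exists>x::'l. x \<noteq> 0" and exact: "cocycles (Suc n) \<subseteq> coboundaries (Suc n)"
  shows "cocycles n \<subseteq> coboundaries n"
proof
  fix f assume "f \<in> cocycles n"
  then have f: "f \<in> cochains n" "cartan_d mul f = (\<lambda>_. 0)" by (auto simp: cocycles_eq)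
  \<comment> \<open>The case \<open>V = {0}\<close> yields a nonzero element annihilated by all left
    multiplications.\<close>
  obtain z where z: "z \<noteq> 0" "\<And>x. mul x z = 0"
    using nilpotent_ex_mul_in_subspace[OF nil subspace_single_0] nonzero by auto
  obtain \<mu> where \<mu>: "is_linear \<mu>" "\<mu> z = 1"
    using ex_functional[OF subspace_single_0, of z] z(1) by auto
  have \<mu>0: "\<mu> 0 = 0"
    using \<mu>(1) unfolding linear_to_field_iff by (metis add_cancel_right_right)
  have mul_z: "mul x y = 0" if "y \<in> span {z}" for x y
    using that z(2) by (auto simp: span_singleton mul_scale_right)
  have ff: "tensor_last f \<mu> \<in> cochains (Suc n)" using f \<mu> by (intro tensor_last_cochains)
  have "\<exists>g\<in>cochains (Suc n). cartan_d mul (tensor_last f \<mu>) = cartan_d mul g \<and>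
      (\<forall>xs. \<forall>y\<in>span {z}. g (xs @ [y]) = 0)"
  proof (rule cocycle_vanishing_on_last[OF fin nil])
    show "\<exists>k\<in>cochains n. f' = cartan_d mul k"
      if "f' \<in> cochains (Suc n)" "cartan_d mul f' = (\<lambda>_. 0)" for f'
      using that exact by (auto simp: cocycles_eq coboundaries_Suc)
    show "cartan_d mul (tensor_last f \<mu>) (xs @ [y]) = 0" if "y \<in> span {z}" for xs y
      using mul_z[OF that] \<mu>0 f(2) by (simp add: cartan_d_tensor_last)
  qed (use mul_z cartan_d_cochains[OF ff] cartan_d_cartan_d[OF ff] in \<open>auto intro: span_zero\<close>)
  then obtain g where g: "g \<in> cochains (Suc n)"
    "cartan_d mul (tensor_last f \<mu>) = cartan_d mul g" "\<And>xs. g (xs @ [z]) = 0"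
    by (auto simp: span_base)
  have "cartan_d mul (\<lambda>xs. tensor_last f \<mu> xs - g xs) = (\<lambda>_. 0)"
    using g(2) by (simp add: cartan_d_diff fun_eq_iff)
  then have "(\<lambda>xs. tensor_last f \<mu> xs - g xs) \<in> coboundaries (Suc n)"
    using exact cochains_diff[OF ff g(1)] by (auto simp: cocycles_eq)
  then obtain h where h: "h \<in> cochains n" "(\<lambda>xs. tensor_last f \<mu> xs - g xs) = cartan_d mul h"
    by (auto simp: coboundaries_Suc)
  \<comment> \<open>With \<open>mul x z = 0\<close>, this is what lets the last slot of
    \<open>h\<close> be frozen at \<open>z\<close>. For \<open>n = 0\<close> it holds because
    \<open>h\<close> is supported on the empty list.\<close>
  have h0: "h (xs @ [0]) = 0" for xs
  proof (cases n)
    case 0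
    then show ?thesis using cochains_length[OF h(1)] by simp
  next
    case (Suc m)
    then show ?thesis using is_linear_last[of h m xs] h(1) unfolding linear_to_field_iff
      by (metis add_cancel_right_right)
  qed
  have f_eq: "f xs = cartan_d mul (\<lambda>zs. h (zs @ [z])) xs" for xs
  proof -
    have "f xs = cartan_d mul h (xs @ [z])"
      using fun_cong[OF h(2), of "xs @ [z]"] g(3) \<mu>(2) by simp
    also have "\<dots> = cartan_d mul (\<lambda>zs. h (zs @ [z])) xs"
      by (rule cartan_d_snoc) (simp add: z(2) h0)
    finally show ?thesis .
  qed
  show "f \<in> coboundaries n"
  proof (cases n)
    case 0
    \<comment> \<open>A cochain \<open>h\<close> of degree 0 vanishes on the nonempty lists
      \<open>zs @ [z]\<close>, so the primitive is 0.\<close>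
    then have "f = (\<lambda>_. 0)" using f_eq cochains_length[OF h(1)] by (auto simp: fun_eq_iff)
    then show ?thesis using 0 by (simp add: coboundaries_0)
  next
    case (Suc m)
    then show ?thesis using f_eq cochains_fix_last[of h m z] h(1)
      by (auto simp: coboundaries_Suc image_iff fun_eq_iff intro!: bexI)
  qed
qed

lemma not_exact:
  assumes "finite_dimensional_vector_space scale B" "nilpotent_algebra mul" "\<exists>x::'l. x \<noteq> 0"
  shows "\<not> cocycles n \<subseteq> coboundaries n"
proof (induction n)
  case 0
  \<comment> \<open>The scalar 1, viewed as a cochain of degree 0; with trivial coefficients it is a
    cocycle, while 0 is the only coboundary there.\<close>
  let ?f = "\<lambda>xs :: 'l list. if xs = [] then 1 else 0 :: 'k"
  have f: "?f \<in> cochains 0" by (simp add: cochains_0_iff)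
  then have "?f \<in> cocycles 0" using cartan_d_cochains_0[OF f] by (simp add: cocycles_eq)
  moreover have "?f \<noteq> (\<lambda>_. 0)" by (auto dest: fun_cong[of _ _ "[]"])
  ultimately show ?case unfolding coboundaries_0 by blast
next
  case (Suc n)
  then show ?case using exact_descend[OF assms] by blast
qed

lemma zero_in_coboundaries: "(\<lambda>_. 0) \<in> coboundaries n"
proof (cases n)
  case (Suc m)
  have "(\<lambda>_. 0) = cartan_d mul (\<lambda>_. 0 :: 'k)" by (simp add: fun_eq_iff)
  then show ?thesis unfolding Suc coboundaries_Suc using cochains_zero by (rule image_eqI)
qed (simp add: coboundaries_0)

end

theorem corollary4p5:
  fixes scale :: "'k::field \<Rightarrow> 'l::ab_group_add \<Rightarrow> 'l"
    and mul :: "'l \<Rightarrow> 'l \<Rightarrow> 'l"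
    and n :: nat
  assumes "leibniz_algebra scale mul"
    and "\<exists>B. finite_dimensional_vector_space scale B"
    and "nilpotent_algebra mul"
    and "\<exists>x::'l. x \<noteq> 0"
  shows "HL scale mul ((*) :: 'k \<Rightarrow> 'k \<Rightarrow> 'k) (\<lambda>_ _. 0) (\<lambda>_ _. 0) n
       \<noteq> {leibniz_class scale mul ((*) :: 'k \<Rightarrow> 'k \<Rightarrow> 'k) (\<lambda>_ _. 0) (\<lambda>_ _. 0) n (\<lambda>_. 0)}"
proof
  interpret L: leibniz_algebra scale mul by fact
  let ?class = "leibniz_class scale mul ((*) :: 'k \<Rightarrow> 'k \<Rightarrow> 'k) (\<lambda>_ _. 0) (\<lambda>_ _. 0) n"
  assume HL: "HL scale mul ((*) :: 'k \<Rightarrow> 'k \<Rightarrow> 'k) (\<lambda>_ _. 0) (\<lambda>_ _. 0) n = {?class (\<lambda>_. 0)}"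
  \<comment> \<open>If the zero class is the only one, each cocycle, lying in its own coset, is a
    coboundary.\<close>
  have "f \<in> L.coboundaries n" if "f \<in> L.cocycles n" for f
  proof -
    have "f \<in> ?class f"
      unfolding leibniz_class_def using L.zero_in_coboundaries[of n]
      by (intro CollectI exI[of _ "\<lambda>_. 0"]) simp
    moreover have "?class f \<in> {?class (\<lambda>_. 0)}"
      unfolding HL[symmetric] HL_def using that by (rule imageI)
    ultimately have "f \<in> ?class (\<lambda>_. 0)" by simp
    then show ?thesis by (simp add: leibniz_class_def)
  qed
  then show False using L.not_exact assms(2-4) by blast
qed

end
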